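(* Let $\mathcal{P}\subset\mathbb{R}^2$ be a point cloud. Given $y_{\min},y_{\max}\in\mathbb{R}$ that satisfy $$y_{\min}\le y\le y_{\max}\quad\text{for all }(x,y)\in\mathcal{P},$$ let $f_w$ be the weighted quasi interpolant spline approximation to $\mathcal{P}$ of degree $p$ over a $(p+1)$-regular knot vector $\mathbf{x}=[x_1,\dots,x_{n+p+1}]$, with respect to some family of weight functions $w_t:\mathbb{R}\to[0,+\infty)$, $t\in\mathbb{R}$. Then $f_w$ has the same bounds: $$y_{\min}\le f_w(x)\le y_{\max}\quad\text{for all }x\in\mathbb{R}.$$
   Context: A point cloud is a finite nonempty set of points. B-splines. For a non-decreasing local knot vector $\mathbf{t}=[t_1,\dots,t_{p+2}]$, the B-spline $B[\mathbf{t}]:\mathbb{R}\to\mathbb{R}$ of degree $p$ is defined recursively by $$B[\mathbf{t}](x)=\frac{x-t_1}{t_{p+1}-t_1}B[t_1,\dots,t_{p+1}](x)+\frac{t_{p+2}-x}{t_{p+2}-t_2}B[t_2,\dots,t_{p+2}](x),$$ with $B[t_i,t_{i+1}](x)=1$ if $x\in[t_i,t_{i+1})$ and $0$ elsewhere, under the convention $0/0=0$. For a global non-decreasing knot vector $\mathbf{x}=[x_1,\dots,x_{n+p+1}]$ put $\mathbf{x}^{(i)}=[x_i,\dots,x_{i+p+1}]$, $i=1,\dots,n$. A knot vector $\mathbf{x}=[x_1,\dots,x_{n+p+1}]$ is $(p+1)$-regular if $n\ge p+1$, $x_1=x_{p+1}$, $x_{n+1}=x_{n+p+1}$, and $x_j<x_{j+p+1}$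 for $j=1,\dots,n$. Weighted quasi interpolant spline approximation (wQISA). Let $p\ge1$ be an integer. The wQISA of degree $p$ to $\mathcal{P}$ over $\mathbf{x}$ is $$f_w(x)=\sum_{i=1}^n\hat y_w(\xi^{(i)})\,B[\mathbf{x}^{(i)}](x),$$ where $\xi^{(i)}=(x_{i+1}+\dots+x_{i+p})/p$ are the knot averages and $$\hat y_w(t)=\frac{\sum_{(x,y)\in\mathcal{P}}y\,w_t(x)}{\sum_{(x,y)\in\mathcal{P}}w_t(x)}$$ are the control points estimators. The denominator is assumed positive at each $t=\xi^{(i)}$, so that $f_w$ is well defined.
   Formalization: The bounds are stated only for x in [x_1, x_{n+p+1}), not all real x: elsewhere (right end knot included) all B-splines vanish, so f_w = 0, and the claim fails e.g. for p=1, knots [0,0,1,1], P={(0,1)}, w=1, y_min=y_max=1. *)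

theory Defs
  imports Complex_Main
begin

definition point_cloud :: "(real \<times> real) set \<Rightarrow> bool" where
  "point_cloud P \<longleftrightarrow> finite P \<and> P \<noteq> {}"

text \<open>
  The degree of the B-spline is \<open>length ts - 2\<close>; lists with fewer than two knots are junk.
  In the recursive clause \<open>last (butlast ts)\<close> is the second to last knot. Since
  \<open>a / 0 = 0\<close> in HOL, a summand with vanishing denominator is zero, which is the convention
  \<open>0 / 0 = 0\<close>: for non-decreasing knots, the B-spline factor of such a summand has only equal knots and so
  vanishes too.
\<close>

fun bspline :: "real list \<Rightarrow> real \<Rightarrow> real" where
  "bspline [] x = 0"
| "bspline [t] x = 0"
| "bspline [t\<^sub>1, t\<^sub>2] x = (if t\<^sub>1 \<le> x \<and> x < t\<^sub>2 then 1 else 0)"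
| "bspline (t\<^sub>1 # t\<^sub>2 # t\<^sub>3 # ts) x =
     (x - t\<^sub>1) / (last (butlast (t\<^sub>1 # t\<^sub>2 # t\<^sub>3 # ts)) - t\<^sub>1)
        * bspline (butlast (t\<^sub>1 # t\<^sub>2 # t\<^sub>3 # ts)) x
   + (last (t\<^sub>1 # t\<^sub>2 # t\<^sub>3 # ts) - x) / (last (t\<^sub>1 # t\<^sub>2 # t\<^sub>3 # ts) - t\<^sub>2)
        * bspline (t\<^sub>2 # t\<^sub>3 # ts) x"

text \<open>
  A global knot vector \<open>[k 1, \<dots>, k (n + p + 1)]\<close> is a function on indices starting at 1; its
  values at other indices are irrelevant.
\<close>

definition knot_vector :: "nat \<Rightarrow> nat \<Rightarrow> (nat \<Rightarrow> real) \<Rightarrow> bool" where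
  "knot_vector p n k \<longleftrightarrow> mono_on {1..n + p + 1} k"

text \<open>Here \<open>p\<close> is the degree: this is \<open>(p + 1)\<close>-regularity.\<close>

definition regular_knot_vector :: "nat \<Rightarrow> nat \<Rightarrow> (nat \<Rightarrow> real) \<Rightarrow> bool" where
  "regular_knot_vector p n k \<longleftrightarrow>
     knot_vector p n k \<and> n \<ge> p + 1 \<and> k 1 = k (p + 1) \<and> k (n + 1) = k (n + p + 1)
     \<and> (\<forall>j\<in>{1..n}. k j < k (j + p + 1))"

definition local_knots :: "nat \<Rightarrow> (nat \<Rightarrow> real) \<Rightarrow> nat \<Rightarrow> real list" where
  "local_knots p k i = map k [i..<i + p + 2]"

definition knot_average :: "nat \<Rightarrow> (nat \<Rightarrow> real) \<Rightarrow> nat \<Rightarrow> real" where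
  "knot_average p k i = (\<Sum>j = i + 1..i + p. k j) / real p"

text \<open>The weight function \<open>w\<^sub>t\<close> is \<open>w t\<close>.\<close>

definition control_point_estimator ::
    "(real \<times> real) set \<Rightarrow> (real \<Rightarrow> real \<Rightarrow> real) \<Rightarrow> real \<Rightarrow> real" where
  "control_point_estimator P w t = (\<Sum>(x, y)\<in>P. y * w t x) / (\<Sum>(x, y)\<in>P. w t x)"

definition wQISA ::
    "nat \<Rightarrow> nat \<Rightarrow> (nat \<Rightarrow> real) \<Rightarrow> (real \<times> real) set \<Rightarrow> (real \<Rightarrow> real \<Rightarrow> real) \<Rightarrow> real \<Rightarrow> real" where
  "wQISA p n k P w x =
     (\<Sum>i = 1..n. control_point_estimator P w (knot_average p k i) * bspline (local_knots p k i) x)"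

text \<open>
  Every \<open>bspline (local_knots p k i)\<close> with \<open>1 \<le> i \<le> n\<close> vanishes outside
  \<open>{k 1..<k (n + p + 1)}\<close> (the right end knot included, since the B-splines of degree 0 are
  indicators of half-open intervals). Hence \<open>wQISA p n k P w\<close> is zero there, and bounds by
  the data can only be expected on this half-open knot interval.
\<close>

end

theory Submission
  imports Defs
begin

text \<open>
  Over a regular knot vector the B-splines of degree \<open>p\<close> are nonnegative and sum to 1 on the knot
  interval (lemmas \<open>bspline_nonneg\<close> and \<open>bspline_partition_of_unity\<close>). The value of the spline at \<open>x\<close>
  is therefore a convex combination of the control point estimators, and each estimator is itself a
  weighted mean of ordinates of the cloud. A convex combination of numbers in \<open>[y_min, y_max]\<close> stays
  there, which is used once for each of the two averages (lemma \<open>weighted_sum_bounds\<close>).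

  The sum is 1 because one step of the recursion splits each B-spline of lower degree into two
  complementary fractions, handed to its two neighbours of higher degree. Summing recollects the
  fractions, except at the two ends of the index range, where the B-spline concerned is supported
  outside the interval (lemma \<open>bspline_support\<close>). Coincident knots do no harm: the B-splines with
  vanishing denominators are zero, again by their support. Regularity enters at the end: since
  the first and last \<open>p + 1\<close> knots coincide, the interval on which the sum is 1 is the whole knot
  interval.
\<close>

lemma bspline_local_knots_0:
  "bspline (local_knots 0 k i) x = (if k i \<le> x \<and> x < k (i + 1) then 1 else 0)"
  by (simp add: local_knots_def upt_rec)

lemma bspline_local_knots_Suc:
  "bspline (local_knots (Suc q) k i) x =
     (x - k i) / (k (i + q + 1) - k i) * bspline (local_knots q k i) x
   + (k (i + q + 2) - x) / (k (i + q + 2) - k (i + 1)) * bspline (local_knots q k (i + 1)) x"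
proof -
  have cons: "local_knots (Suc q) k i = k i # local_knots q k (i + 1)"
    by (simp add: local_knots_def upt_rec)
  have cons3: "local_knots (Suc q) k i
      = k i # k (i + 1) # k (i + 2) # map k [i + 3..<i + q + 3]"
    by (simp add: local_knots_def upt_rec[of i] upt_rec[of "Suc i"] upt_rec[of "Suc (Suc i)"]
        numeral_eq_Suc del: upt_Suc)
  have ends: "butlast (local_knots (Suc q) k i) = local_knots q k i"
    "last (local_knots (Suc q) k i) = k (i + q + 2)"
    "last (local_knots q k i) = k (i + q + 1)"
    by (simp_all add: local_knots_def butlast_append)
  have tl: "k (i + 1) # k (i + 2) # map k [i + 3..<i + q + 3] = local_knots q k (i + 1)"
    using cons cons3 by simp
  show ?thesis
    using bspline.simps(4)[of "k i" "k (i + 1)" "k (i + 2)" "map k [i + 3..<i + q + 3]" x]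
    unfolding tl cons[symmetric] ends .
qed

lemma bspline_support:
  assumes "mono_on {i..i + q + 1} k"
    and "bspline (local_knots q k i) x \<noteq> 0"
  shows "k i \<le> x \<and> x < k (i + q + 1)"
  using assms
proof (induction q arbitrary: i)
  case 0
  then show ?case
    by (simp add: bspline_local_knots_0 split: if_splits)
next
  case (Suc q)
  have mono: "mono_on {i..i + q + 1} k" "mono_on {i + 1..i + 1 + q + 1} k"
    using Suc.prems(1) by (auto elim!: mono_on_subset)
  have ends: "k i \<le> k (i + 1)" "k (i + q + 1) \<le> k (i + q + 2)"
    using Suc.prems(1) by (auto intro!: mono_onD[OF Suc.prems(1)])
  have "bspline (local_knots q k i) x \<noteq> 0 \<or> bspline (local_knots q k (i + 1)) x \<noteq> 0"
    using Suc.prems(2) unfolding bspline_local_knots_Suc by auto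
  then show ?case
    using Suc.IH[OF mono(1)] Suc.IH[OF mono(2)] ends by auto
qed

text \<open>
  The coefficients in the recursion are negative outside the support of the factor they multiply, so
  nonnegativity needs the support in the induction.
\<close>

lemma bspline_nonneg:
  assumes "mono_on {i..i + q + 1} k"
  shows "bspline (local_knots q k i) x \<ge> 0"
  using assms
proof (induction q arbitrary: i)
  case 0
  then show ?case
    by (simp add: bspline_local_knots_0)
next
  case (Suc q)
  have mono: "mono_on {i..i + q + 1} k" "mono_on {i + 1..i + 1 + q + 1} k"
    using Suc.prems by (auto elim!: mono_on_subset)
  have "(x - k i) / (k (i + q + 1) - k i) * bspline (local_knots q k i) x \<ge> 0"
    using Suc.IH[OF mono(1)] bspline_support[OF mono(1), of x]
    by (cases "bspline (local_knots q k i) x = 0") auto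
  moreover have "(k (i + q + 2) - x) / (k (i + q + 2) - k (i + 1))
      * bspline (local_knots q k (i + 1)) x \<ge> 0"
    using Suc.IH[OF mono(2)] bspline_support[OF mono(2), of x]
    by (cases "bspline (local_knots q k (i + 1)) x = 0") auto
  ultimately show ?case
    unfolding bspline_local_knots_Suc by linarith
qed

lemma sum_indicators_of_knot_intervals:
  fixes k :: "nat \<Rightarrow> real"
  assumes "a \<le> b" and "mono_on {a..b} k" and "k a \<le> x"
  shows "(\<Sum>i = a..<b. if k i \<le> x \<and> x < k (i + 1) then 1 else 0) = (if x < k b then 1 else (0::real))"
  using assms
proof (induction b rule: dec_induct)
  case base
  then show ?case by simp
next
  case (step b)
  have "mono_on {a..b} k"
    using step.prems(1) by (auto elim!: mono_on_subset)
  moreover have "k b \<le> k (Suc b)"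
    using step.hyps by (intro mono_onD[OF step.prems(1)]) auto
  ultimately show ?case
    using step by auto
qed

text \<open>
  The interval \<open>{k a..<k b}\<close> stays the same in the induction on the degree, while the index range grows
  by one at its left end. Each boundary term of the recursion then has its support on one side
  of it, left of \<open>k a\<close> or right of \<open>k b\<close>.
\<close>

lemma bspline_partition_of_unity:
  assumes "q \<le> a" and "a \<le> b" and "mono_on {a - q..b + q} k"
    and "k a \<le> x" and "x < k b"
  shows "(\<Sum>i = a - q..<b. bspline (local_knots q k i) x) = 1"
  using assms(1,3)
proof (induction q)
  case 0
  then show ?case
    using sum_indicators_of_knot_intervals[of a b k x] assms(2,4,5)
    by (simp add: bspline_local_knots_0)
next
  case (Suc q)
  define c where "c = a - Suc q"
  have c: "a - q = Suc c" "a = c + q + 1" "c < b"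
    using Suc.prems(1) assms(2) by (auto simp: c_def)
  have mono: "mono_on {i..i + q + 1} k" if "c \<le> i" "i \<le> b" for i
    using Suc.prems(2) that by (auto simp: c_def elim!: mono_on_subset)
  define N where "N i = bspline (local_knots q k i) x" for i
  define u where "u i = (x - k i) / (k (i + q + 1) - k i) * N i" for i
  define v where "v i = (k (i + q + 1) - x) / (k (i + q + 1) - k i) * N i" for i
  have "N c = 0"
    using bspline_support[OF mono[of c], of x] c assms(4) by (auto simp: N_def)
  then have left: "u c = 0"
    by (simp add: u_def)
  have "N b = 0"
    using bspline_support[OF mono[of b], of x] c assms(5) by (auto simp: N_def)
  then have right: "v b = 0"
    by (simp add: v_def)
  have fractions: "u i + v i = N i" if "i \<in> {Suc c..<b}" for i
  proof (cases "N i = 0")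
    case True
    then show ?thesis by (simp add: u_def v_def)
  next
    case False
    then have "k i < k (i + q + 1)"
      using bspline_support[OF mono[of i], of x] that by (auto simp: N_def)
    then have "(x - k i) / (k (i + q + 1) - k i) + (k (i + q + 1) - x) / (k (i + q + 1) - k i) = 1"
      by (simp add: add_divide_distrib[symmetric])
    then show ?thesis
      unfolding u_def v_def by (metis distrib_right mult_1)
  qed
  have "(\<Sum>i = c..<b. bspline (local_knots (Suc q) k i) x) = (\<Sum>i = c..<b. u i + v (Suc i))"
    by (simp add: bspline_local_knots_Suc u_def v_def N_def)
  also have "\<dots> = (\<Sum>i = c..<b. u i) + (\<Sum>i = Suc c..<Suc b. v i)"
    by (simp only: sum.distrib sum.shift_bounds_Suc_ivl)
  also have "\<dots> = (\<Sum>i = Suc c..<b. u i) + (\<Sum>i = Suc c..<b. v i)"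
    using c(3) left right by (simp add: sum.atLeast_Suc_lessThan)
  also have "\<dots> = (\<Sum>i = a - q..<b. N i)"
    using fractions by (simp add: c(1) sum.distrib[symmetric])
  also have "\<dots> = 1"
    unfolding N_def using Suc.prems by (intro Suc.IH) (auto elim!: mono_on_subset)
  finally show ?case
    by (simp add: c_def)
qed

lemma weighted_sum_bounds:
  fixes f g :: "'a \<Rightarrow> real"
  assumes "\<And>i. i \<in> A \<Longrightarrow> g i \<ge> 0" and "\<And>i. i \<in> A \<Longrightarrow> l \<le> f i \<and> f i \<le> u"
  shows "l * sum g A \<le> (\<Sum>i\<in>A. f i * g i) \<and> (\<Sum>i\<in>A. f i * g i) \<le> u * sum g A"
  unfolding sum_distrib_left using assms by (auto intro!: sum_mono mult_right_mono)

lemma control_point_estimator_bounds: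
  assumes "\<And>x y. (x, y) \<in> P \<Longrightarrow> l \<le> y \<and> y \<le> u"
    and "\<And>x. w t x \<ge> 0"
    and "(\<Sum>(x, y)\<in>P. w t x) > 0"
  shows "l \<le> control_point_estimator P w t \<and> control_point_estimator P w t \<le> u"
  using weighted_sum_bounds[of P "\<lambda>(x, y). w t x" l "\<lambda>(x, y). y" u] assms
  by (auto simp: control_point_estimator_def case_prod_beta' pos_le_divide_eq pos_divide_le_eq)

theorem propositionA1:
  fixes P :: "(real \<times> real) set"
    and y_min y_max :: real
    and p n :: nat
    and k :: "nat \<Rightarrow> real"
    and w :: "real \<Rightarrow> real \<Rightarrow> real"
  assumes "point_cloud P"
    and "\<And>x y. (x, y) \<in> P \<Longrightarrow> y_min \<le> y \<and> y \<le> y_max"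
    and "p \<ge> 1"
    and "regular_knot_vector p n k"
    and "\<And>t x. w t x \<ge> 0"
    and "\<And>i. i \<in> {1..n} \<Longrightarrow> (\<Sum>(x, y)\<in>P. w (knot_average p k i) x) > 0"
  shows "\<forall>x\<in>{k 1..<k (n + p + 1)}. y_min \<le> wQISA p n k P w x \<and> wQISA p n k P w x \<le> y_max"
proof
  fix x assume x: "x \<in> {k 1..<k (n + p + 1)}"
  let ?B = "\<lambda>i. bspline (local_knots p k i) x"
  have mono: "mono_on {1..n + p + 1} k" and "n \<ge> p + 1"
    and clamped: "k 1 = k (p + 1)" "k (n + 1) = k (n + p + 1)"
    using assms(4) by (auto simp: regular_knot_vector_def knot_vector_def)
  have nonneg: "?B i \<ge> 0" if "i \<in> {1..n}" for i
    using that by (intro bspline_nonneg mono_on_subset[OF mono]) auto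
  have "(\<Sum>i = p + 1 - p..<n + 1. ?B i) = 1"
    using x clamped mono \<open>n \<ge> p + 1\<close>
    by (intro bspline_partition_of_unity) (auto simp: algebra_simps)
  then have "(\<Sum>i = 1..n. ?B i) = 1"
    by (simp add: atLeastLessThanSuc_atLeastAtMost)
  moreover have "y_min \<le> control_point_estimator P w (knot_average p k i) \<and>
      control_point_estimator P w (knot_average p k i) \<le> y_max" if "i \<in> {1..n}" for i
    using assms(2,5) assms(6)[OF that] by (intro control_point_estimator_bounds) auto
  ultimately show "y_min \<le> wQISA p n k P w x \<and> wQISA p n k P w x \<le> y_max"
    using weighted_sum_bounds[of "{1..n}" ?B y_min
        "\<lambda>i. control_point_estimator P w (knot_average p k i)" y_max] nonneg
    by (simp add: wQISA_def)
qed

end
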